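(* Let $A$ be a unital $C^{*}$-algebra and let $a, b \in A_{sa}$. If $\sigma(ay)=\sigma(by)$ for every $y \in A_{+}^{-1}$, then $a=b$.
   Context: $C^*$-algebras are complex. $A_{sa}$ denotes the set of all self-adjoint elements of $A$, $A_{+}^{-1}$ denotes the set of all positive invertible elements of $A$, and $\sigma(\cdot)$ denotes the spectrum of an element of $A$. *)

theory Defs
  imports Complex_Main
begin

text \<open>
  The class is built on \<^class>\<open>monoid_mult\<close> rather than \<^class>\<open>real_normed_algebra_1\<close>,
  since the latter imposes \<open>0 \<noteq> 1\<close> and would exclude the zero algebra. For a nonzero algebra,
  \<open>norm 1 = 1\<close> follows from the C*-identity. Completeness comes from \<^class>\<open>banach\<close>,
  submultiplicativity of the norm from \<^class>\<open>real_normed_algebra\<close>.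
\<close>

class unital_cstar_algebra = real_normed_algebra + banach + monoid_mult +
  fixes scaleC :: "complex \<Rightarrow> 'a \<Rightarrow> 'a" (infixr "*\<^sub>C" 75)
    and star :: "'a \<Rightarrow> 'a"
  assumes scaleR_scaleC: "scaleR r x = complex_of_real r *\<^sub>C x"
    and scaleC_add_right: "c *\<^sub>C (x + y) = c *\<^sub>C x + c *\<^sub>C y"
    and scaleC_add_left: "(c + d) *\<^sub>C x = c *\<^sub>C x + d *\<^sub>C x"
    and scaleC_scaleC: "c *\<^sub>C (d *\<^sub>C x) = (c * d) *\<^sub>C x"
    and scaleC_one: "1 *\<^sub>C x = x"
    and mult_scaleC_left: "(c *\<^sub>C x) * y = c *\<^sub>C (x * y)"
    and mult_scaleC_right: "x * (c *\<^sub>C y) = c *\<^sub>C (x * y)"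
    and norm_scaleC: "norm (c *\<^sub>C x) = cmod c * norm x"
    and star_add: "star (x + y) = star x + star y"
    and star_scaleC: "star (c *\<^sub>C x) = cnj c *\<^sub>C star x"
    and star_mult: "star (x * y) = star y * star x"
    and star_star: "star (star x) = x"
    and cstar_identity: "norm (star x * x) = (norm x)\<^sup>2"

instantiation complex :: unital_cstar_algebra
begin

definition scaleC_complex :: "complex \<Rightarrow> complex \<Rightarrow> complex"
  where "scaleC_complex c x = c * x"

definition star_complex :: "complex \<Rightarrow> complex"
  where "star_complex x = cnj x"

instance
  by standard
    (auto simp: scaleC_complex_def star_complex_def scaleR_conv_of_real algebra_simps
      norm_mult power2_eq_square)

end

definition self_adjoint :: "'a::unital_cstar_algebra \<Rightarrow> bool"
  where "self_adjoint x \<longleftrightarrow> star x = x"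

definition invertible_element :: "'a::monoid_mult \<Rightarrow> bool"
  where "invertible_element x \<longleftrightarrow> (\<exists>y. x * y = 1 \<and> y * x = 1)"

definition spectrum :: "'a::unital_cstar_algebra \<Rightarrow> complex set"
  where "spectrum x = {c. \<not> invertible_element (c *\<^sub>C 1 - x)}"

definition positive_element :: "'a::unital_cstar_algebra \<Rightarrow> bool"
  where "positive_element x \<longleftrightarrow> self_adjoint x \<and> spectrum x \<subseteq> complex_of_real ` {0..}"

end

theory Submission
  imports Defs "HOL-Analysis.Topology_Euclidean_Space"
begin

text \<open>
  For self-adjoint invertible \<open>c\<close>, the element \<open>c * a * c\<close> is similar to \<open>a * (c * c)\<close>, so
  \<open>c * a * c\<close> and \<open>c * b * c\<close> have the same spectrum. Let \<open>d = a - b\<close> be nonzero, scaled by a real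
  number so that \<open>norm d = 1\<close> and \<open>1\<close> lies in its spectrum. Taking for \<open>c\<close> a high power of
  \<open>(2 + d)\<^sup>2\<close>, which concentrates near the spectral value \<open>1\<close>, gives
  \<open>c * d * c \<ge> c\<^sup>2 / 2 - \<delta>\<close> with \<open>\<delta>\<close> negligible compared to the norm of \<open>c\<^sup>2\<close>. If
  \<open>c * a * c \<le> N\<close>, then \<open>c * b * c \<le> N + \<delta> - c\<^sup>2 / 2\<close>, and \<open>c * b * c \<le> \<beta> c\<^sup>2\<close> with
  \<open>\<beta> > norm b\<close> turns this into \<open>(1 + 1 / (2 \<beta>)) (c * b * c) \<le> N + \<delta>\<close>. As both elements have the same
  spectral maximum, that maximum is at most \<open>2 \<beta> \<delta>\<close>. The same argument for \<open>- b\<close> and \<open>- a\<close> bounds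
  \<open>- c * b * c\<close>. Hence \<open>c * d * c\<close>, and with it \<open>c\<^sup>2\<close>, is bounded by a multiple of \<open>\<delta>\<close>, a contradiction.
\<close>

section \<open>Scalars, involution and norm\<close>

lemma scaleC_zero_left [simp]: "0 *\<^sub>C (x::'a::unital_cstar_algebra) = 0"
  using scaleC_add_left[of 0 0 x] by simp

lemma scaleC_minus_left: "(- c) *\<^sub>C (x::'a::unital_cstar_algebra) = - (c *\<^sub>C x)"
  using scaleC_add_left[of "- c" c x] by (simp add: eq_neg_iff_add_eq_0)

lemma scaleC_diff_left: "(c - d) *\<^sub>C (x::'a::unital_cstar_algebra) = c *\<^sub>C x - d *\<^sub>C x"
  using scaleC_add_left[of c "- d" x] by (simp add: scaleC_minus_left)

lemma scaleC_zero_right [simp]: "c *\<^sub>C (0::'a::unital_cstar_algebra) = 0"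
  using scaleC_add_right[of c 0 "0::'a"] by simp

lemma scaleC_minus_right: "c *\<^sub>C (- (x::'a::unital_cstar_algebra)) = - (c *\<^sub>C x)"
  using scaleC_add_right[of c "- x" x] by (simp add: eq_neg_iff_add_eq_0)

lemma scaleC_diff_right: "c *\<^sub>C ((x::'a::unital_cstar_algebra) - y) = c *\<^sub>C x - c *\<^sub>C y"
  using scaleC_add_right[of c x "- y"] by (simp add: scaleC_minus_right)

lemmas scaleC_simps = scaleC_add_left scaleC_add_right scaleC_diff_left scaleC_diff_right
  scaleC_minus_left scaleC_minus_right scaleC_scaleC scaleC_one mult_scaleC_left mult_scaleC_right

lemma power_scaleC: "(c *\<^sub>C (x::'a::unital_cstar_algebra)) ^ n = c ^ n *\<^sub>C x ^ n"
  by (induction n) (simp_all add: scaleC_simps mult_ac)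

lemma star_one [simp]: "star (1::'a::unital_cstar_algebra) = 1"
  by (metis star_mult star_star mult_1_right)

lemma star_zero [simp]: "star (0::'a::unital_cstar_algebra) = 0"
  using star_add[of 0 "0::'a"] by simp

lemma star_minus: "star (- (x::'a::unital_cstar_algebra)) = - star x"
  using star_add[of "- x" x] by (simp add: eq_neg_iff_add_eq_0)

lemma star_diff: "star ((x::'a::unital_cstar_algebra) - y) = star x - star y"
  using star_add[of x "- y"] by (simp add: star_minus)

lemma star_scaleR: "star (r *\<^sub>R (x::'a::unital_cstar_algebra)) = r *\<^sub>R star x"
  by (simp add: scaleR_scaleC star_scaleC)

lemma self_adjoint_one: "self_adjoint (1::'a::unital_cstar_algebra)"
  by (simp add: self_adjoint_def)

lemma self_adjoint_add: "self_adjoint x \<Longrightarrow> self_adjoint y \<Longrightarrow> self_adjoint (x + y)"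
  by (simp add: self_adjoint_def star_add)

lemma self_adjoint_diff: "self_adjoint x \<Longrightarrow> self_adjoint y \<Longrightarrow> self_adjoint (x - y)"
  by (simp add: self_adjoint_def star_diff)

lemma self_adjoint_minus: "self_adjoint x \<Longrightarrow> self_adjoint (- x)"
  by (simp add: self_adjoint_def star_minus)

lemma self_adjoint_scaleR: "self_adjoint x \<Longrightarrow> self_adjoint (r *\<^sub>R x)"
  by (simp add: self_adjoint_def star_scaleR)

lemma self_adjoint_conjugate: "self_adjoint x \<Longrightarrow> self_adjoint c \<Longrightarrow> self_adjoint (c * x * c)"
  by (simp add: self_adjoint_def star_mult mult.assoc)

lemma self_adjoint_power: "self_adjoint x \<Longrightarrow> self_adjoint (x ^ n)"
  by (induction n) (simp_all add: self_adjoint_def star_mult power_commutes)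

lemma self_adjoint_inverse:
  assumes "self_adjoint c" "c * e = 1" "e * c = 1"
  shows "self_adjoint e"
proof -
  have "star e * c = 1"
    using assms by (metis self_adjoint_def star_mult star_one)
  then have "star e = e"
    by (metis assms(2) mult.assoc mult_1_left mult_1_right)
  then show ?thesis by (simp add: self_adjoint_def)
qed

lemmas self_adjoint_intros = self_adjoint_one self_adjoint_add self_adjoint_diff
  self_adjoint_minus self_adjoint_scaleR self_adjoint_conjugate self_adjoint_power

lemma norm_self_adjoint_square: "self_adjoint x \<Longrightarrow> norm (x * x) = (norm x)\<^sup>2"
  using cstar_identity[of x] by (simp add: self_adjoint_def)

lemma norm_self_adjoint_power:
  assumes "self_adjoint x"
  \<comment> \<open>Exponents are powers of two because the C*-identity is iterated; each squaring
    stays self-adjoint.\<close>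
  shows "norm (x ^ 2 ^ n) = norm x ^ 2 ^ n"
proof (induction n)
  case (Suc n)
  have "norm (x ^ 2 ^ Suc n) = norm (x ^ 2 ^ n * x ^ 2 ^ n)"
    by (simp add: power_add[symmetric] mult_2)
  also have "\<dots> = (norm (x ^ 2 ^ n))\<^sup>2"
    by (rule norm_self_adjoint_square) (intro self_adjoint_intros assms)
  finally show ?case
    using Suc by (simp add: power_mult[symmetric] mult.commute)
qed simp

text \<open>The C*-identity makes \<open>norm 1\<close> a root of n^2 = n; the root 0 occurs in the
  zero algebra, which the class admits.\<close>

lemma norm_one_le: "norm (1::'a::unital_cstar_algebra) \<le> 1"
proof -
  have "norm (1::'a) = (norm (1::'a))\<^sup>2"
    using cstar_identity[of "1::'a"] by simp
  then have "norm (1::'a) * (norm (1::'a) - 1) = 0"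
    by (simp add: power2_eq_square algebra_simps)
  then show ?thesis by auto
qed

lemma norm_scaleR_one_le: "norm (r *\<^sub>R (1::'a::unital_cstar_algebra)) \<le> \<bar>r\<bar>"
  using mult_left_mono[OF norm_one_le, of "\<bar>r\<bar>"] by simp

lemma norm_power_le: "norm ((x::'a::unital_cstar_algebra) ^ n) \<le> norm x ^ n"
proof (induction n)
  case (Suc n)
  have "norm (x ^ Suc n) \<le> norm x * norm (x ^ n)"
    by (simp add: norm_mult_ineq)
  also have "\<dots> \<le> norm x * norm x ^ n"
    by (intro mult_left_mono Suc) simp
  finally show ?case by simp
qed (simp add: norm_one_le)

section \<open>Invertible elements\<close>

lemma invertible_elementI: "x * y = 1 \<Longrightarrow> y * x = 1 \<Longrightarrow> invertible_element x"
  by (auto simp: invertible_element_def)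

lemma invertible_element_mult:
  assumes "invertible_element x" "invertible_element y"
  shows "invertible_element (x * y)"
proof -
  obtain x' y' where "x * x' = 1" "x' * x = 1" "y * y' = 1" "y' * y = 1"
    using assms by (auto simp: invertible_element_def)
  then show ?thesis
    by (intro invertible_elementI[of _ "y' * x'"]) (metis mult.assoc mult_1_left)+
qed

lemma invertible_element_power: "invertible_element x \<Longrightarrow> invertible_element (x ^ n)"
  by (induction n) (auto intro: invertible_element_mult invertible_elementI[of 1 1])

text \<open>Commutation turns an inverse of the product into both a right and a left inverse of
  \<open>x\<close>, and these coincide.\<close>

lemma invertible_element_factor:
  assumes "x * y = y * x" "invertible_element (x * y)"
  shows "invertible_element x"
proof -
  obtain z where z: "x * y * z = 1" "z * (x * y) = 1"
    using assms(2) by (auto simp: invertible_element_def)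
  have "x * (y * z) = 1" using z(1) by (simp only: mult.assoc)
  moreover have "z * y * x = 1" using z(2) assms(1) by (simp add: mult.assoc)
  moreover from calculation have "y * z = z * y"
    by (metis mult.assoc mult_1_left mult_1_right)
  ultimately show ?thesis by (intro invertible_elementI) simp_all
qed

lemma invertible_element_conjugate_iff:
  fixes c :: "'a::monoid_mult"
  assumes "invertible_element c" "invertible_element d"
  shows "invertible_element (c * x * d) \<longleftrightarrow> invertible_element x"
proof -
  obtain e f where e: "c * e = 1" "e * c = 1" and f: "d * f = 1" "f * d = 1"
    using assms by (auto simp: invertible_element_def)
  have "e * (c * x * d) * f = (e * c) * x * (d * f)" by (simp add: mult.assoc)
  then have "x = e * (c * x * d) * f" using e f by simp
  moreover have "invertible_element e" "invertible_element f"
    using e f by (auto intro: invertible_elementI)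
  ultimately show ?thesis
    using assms by (metis invertible_element_mult)
qed

lemma invertible_element_scaleC:
  assumes "c \<noteq> 0" "invertible_element (x::'a::unital_cstar_algebra)"
  shows "invertible_element (c *\<^sub>C x)"
proof -
  obtain y where "x * y = 1" "y * x = 1" using assms by (auto simp: invertible_element_def)
  then show ?thesis using assms(1)
    by (intro invertible_elementI[of _ "inverse c *\<^sub>C y"]) (simp_all add: scaleC_simps)
qed

lemma invertible_element_scaleR_iff:
  assumes "r \<noteq> 0"
  shows "invertible_element (r *\<^sub>R (x::'a::unital_cstar_algebra)) \<longleftrightarrow> invertible_element x"
proof
  assume "invertible_element (r *\<^sub>R x)"
  then have "invertible_element (of_real (inverse r) *\<^sub>C (r *\<^sub>R x))"
    using assms by (intro invertible_element_scaleC) auto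
  moreover have "of_real (inverse r) *\<^sub>C (r *\<^sub>R x) = x"
    unfolding scaleR_scaleC scaleC_scaleC of_real_mult[symmetric] using assms by (simp add: scaleC_one)
  ultimately show "invertible_element x" by simp
qed (use assms in \<open>simp add: scaleR_scaleC invertible_element_scaleC\<close>)

text \<open>Neumann series; completeness of the algebra enters here.\<close>

lemma invertible_element_one_diff:
  assumes "norm (x::'a::unital_cstar_algebra) < 1"
  shows "invertible_element (1 - x)"
proof -
  have s: "summable (\<lambda>n. x ^ n)"
    by (rule summable_comparison_test[of _ "\<lambda>n. norm x ^ n"])
      (use assms norm_power_le in \<open>auto intro: summable_geometric\<close>)
  define S where "S = (\<Sum>n. x ^ n)"
  have "S - 1 = (\<Sum>n. x ^ Suc n)"
    using suminf_split_head[OF s] by (simp add: S_def)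
  moreover have "(\<Sum>n. x ^ Suc n) = x * S"
    unfolding S_def using suminf_mult[OF s, of x] by simp
  moreover have "(\<Sum>n. x ^ Suc n) = S * x"
    unfolding S_def using suminf_mult2[OF s, of x] by (simp add: power_commutes)
  ultimately have "S = 1 + x * S" "S = 1 + S * x" by (simp_all add: algebra_simps)
  then show ?thesis
    by (intro invertible_elementI[of _ S]) (simp_all add: algebra_simps)
qed

lemma invertible_element_scaleC_one_diff:
  assumes "norm (x::'a::unital_cstar_algebra) < cmod z"
  shows "invertible_element (z *\<^sub>C 1 - x)"
proof -
  have "z \<noteq> 0" using assms by auto
  then have "norm (inverse z *\<^sub>C x) < 1"
    using assms by (simp add: norm_scaleC norm_inverse norm_divide field_simps)
  then have "invertible_element (z *\<^sub>C (1 - inverse z *\<^sub>C x))"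
    using \<open>z \<noteq> 0\<close> by (intro invertible_element_scaleC invertible_element_one_diff)
  then show ?thesis using \<open>z \<noteq> 0\<close> by (simp add: scaleC_simps)
qed

lemma invertible_element_scaleR_one_diff:
  assumes "norm (x::'a::unital_cstar_algebra) < \<bar>r\<bar>"
  shows "invertible_element (r *\<^sub>R 1 - x)"
  using invertible_element_scaleC_one_diff[of x "of_real r"] assms by (simp add: scaleR_scaleC)

text \<open>
  Adding \<open>\<i> t\<close> moves the spectrum vertically by \<open>t\<close>, while the C*-identity bounds the
  norm of \<open>x + \<i> t\<close> by the square root of \<open>(norm x)\<^sup>2 + t\<^sup>2\<close>; a point off the real
  axis leaves that disc for suitable \<open>t\<close>.
\<close>
lemma invertible_element_nonreal:
  assumes x: "self_adjoint (x::'a::unital_cstar_algebra)" and z: "Im z \<noteq> 0"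
  shows "invertible_element (z *\<^sub>C 1 - x)"
proof -
  \<comment> \<open>Solves 2 * Im z * t = (norm x)^2 + 1, so the cross term of |z + it|^2 outweighs
    (norm x)^2.\<close>
  define t where "t = ((norm x)\<^sup>2 + 1) / (2 * Im z)"
  define w where "w = x + (\<i> * of_real t) *\<^sub>C 1"
  have "star w * w = x * x + (t\<^sup>2) *\<^sub>R 1"
    using x unfolding w_def self_adjoint_def
    by (simp add: star_add star_scaleC scaleC_simps scaleR_scaleC algebra_simps power2_eq_square)
  then have "(norm w)\<^sup>2 = norm (x * x + (t\<^sup>2) *\<^sub>R 1)"
    using cstar_identity[of w] by simp
  also have "\<dots> \<le> (norm x)\<^sup>2 + t\<^sup>2"
    using norm_triangle_ineq[of "x * x" "t\<^sup>2 *\<^sub>R 1"] norm_scaleR_one_le[of "t\<^sup>2", where 'a='a]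
      norm_self_adjoint_square[OF x] by simp
  also have "\<dots> < (cmod (z + \<i> * of_real t))\<^sup>2"
  proof -
    have "2 * Im z * t = (norm x)\<^sup>2 + 1" using z by (simp add: t_def)
    moreover have "(cmod (z + \<i> * of_real t))\<^sup>2 = (Re z)\<^sup>2 + (Im z)\<^sup>2 + 2 * Im z * t + t\<^sup>2"
      by (simp add: cmod_power2 power2_sum)
    ultimately show ?thesis by (simp add: add_nonneg_pos)
  qed
  finally have "norm w < cmod (z + \<i> * of_real t)"
    by (rule power_less_imp_less_base) simp
  then have "invertible_element ((z + \<i> * of_real t) *\<^sub>C 1 - w)"
    by (rule invertible_element_scaleC_one_diff)
  then show ?thesis by (simp add: w_def scaleC_simps)
qed

text \<open>With w a square root of z, z - x^2 = (w - x)(w + x). Since z is not a nonnegative real,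
  w is not real and both factors are invertible.\<close>

lemma invertible_element_diff_square:
  assumes x: "self_adjoint (x::'a::unital_cstar_algebra)" and z: "z \<notin> complex_of_real ` {0..}"
  shows "invertible_element (z *\<^sub>C 1 - x * x)"
proof -
  define w where "w = csqrt z"
  have zw: "z = w * w" by (simp add: w_def power2_eq_square[symmetric])
  have im: "Im w \<noteq> 0"
  proof
    assume "Im w = 0"
    then have "z = of_real (Re w * Re w)" by (simp add: zw complex_eq_iff)
    moreover have "Re w * Re w \<in> {0..}" by simp
    ultimately show False using z by blast
  qed
  have "invertible_element (- ((- w) *\<^sub>C 1 - x))"
    using invertible_element_scaleC[OF _ invertible_element_nonreal[OF x, of "- w"], of "-1"] im
    by (simp add: scaleC_simps add.commute)
  then have "invertible_element ((w *\<^sub>C 1 - x) * (- ((- w) *\<^sub>C 1 - x)))"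
    using im x by (intro invertible_element_mult invertible_element_nonreal)
  then show ?thesis by (simp add: zw scaleC_simps algebra_simps)
qed

section \<open>The norm of a self-adjoint element\<close>

text \<open>The resolvent identity R z - R w = (z - w) R z h R w turns a norm bound on R into a
  Lipschitz bound. The norm bound is first local; compactness of the closed disc makes it
  global.\<close>

lemma resolvent_lipschitz_on_disc:
  fixes h :: "'a::unital_cstar_algebra"
  assumes "\<And>z. cmod z \<le> 1 \<Longrightarrow> invertible_element (1 - z *\<^sub>C h)"
  obtains R K where "\<And>z. cmod z \<le> 1 \<Longrightarrow> (1 - z *\<^sub>C h) * R z = 1"
    and "\<And>z. cmod z \<le> 1 \<Longrightarrow> norm (R z) \<le> K"
    and "\<And>z w. cmod z \<le> 1 \<Longrightarrow> cmod w \<le> 1 \<Longrightarrow> norm (R z - R w) \<le> K * cmod (z - w)"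
proof -
  have "\<forall>z. \<exists>y. cmod z \<le> 1 \<longrightarrow> (1 - z *\<^sub>C h) * y = 1 \<and> y * (1 - z *\<^sub>C h) = 1"
    using assms unfolding invertible_element_def by blast
  then obtain R where R: "\<And>z. cmod z \<le> 1 \<Longrightarrow> (1 - z *\<^sub>C h) * R z = 1"
      "\<And>z. cmod z \<le> 1 \<Longrightarrow> R z * (1 - z *\<^sub>C h) = 1"
    by metis
  have resolvent: "norm (R z - R w) \<le> cmod (z - w) * norm h * norm (R z) * norm (R w)"
    if "cmod z \<le> 1" "cmod w \<le> 1" for z w
  proof -
    have "R z - R w = R z * ((1 - w *\<^sub>C h) * R w) - (R z * (1 - z *\<^sub>C h)) * R w"
      using R that by simp
    also have "\<dots> = (z - w) *\<^sub>C (R z * h * R w)"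
      by (simp add: algebra_simps scaleC_simps)
    finally have "norm (R z - R w) = cmod (z - w) * norm (R z * h * R w)"
      by (simp add: norm_scaleC)
    also have "norm (R z * h * R w) \<le> norm (R z) * norm h * norm (R w)"
      by (meson norm_mult_ineq mult_right_mono norm_ge_zero order_trans)
    finally have "norm (R z - R w) \<le> cmod (z - w) * (norm (R z) * norm h * norm (R w))"
      by (simp add: mult_left_mono)
    then show ?thesis by (simp add: mult_ac)
  qed
  \<comment> \<open>Within this radius |z - w| * norm h * norm (R w) is at most 1/2, and the
    resolvent identity can be absorbed into \<open>norm (R z)\<close>.\<close>
  define r where "r w = 1 / (2 * (norm h * norm (R w) + 1))" for w
  have r: "r w > 0" for w
    by (simp add: r_def add_nonneg_pos)
  have loc: "norm (R z) \<le> 2 * norm (R w)"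
    if "cmod z \<le> 1" "cmod w \<le> 1" "z \<in> ball w (r w)" for z w
  proof -
    have "cmod (z - w) * (norm h * norm (R w)) \<le> r w * (norm h * norm (R w))"
      using that by (intro mult_right_mono) (auto simp: dist_norm norm_minus_commute)
    also have "\<dots> \<le> 1 / 2"
    proof -
      have "x / (2 * (x + 1)) \<le> 1 / 2" if "0 \<le> x" for x :: real
        using that by (simp add: divide_simps)
      from this[of "norm h * norm (R w)"] show ?thesis by (simp add: r_def)
    qed
    finally have "cmod (z - w) * (norm h * norm (R w)) * norm (R z) \<le> 1 / 2 * norm (R z)"
      by (rule mult_right_mono) simp
    then have "norm (R z - R w) \<le> 1 / 2 * norm (R z)"
      using resolvent[OF that(1,2)] by (simp add: mult_ac)
    then show ?thesis
      using norm_triangle_ineq2[of "R z" "R w"] by linarith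
  qed
  obtain D where D: "D \<subseteq> cball 0 1" "finite D" "cball 0 1 \<subseteq> (\<Union>w\<in>D. ball w (r w))"
    by (rule compactE_image[of "cball (0::complex) 1" "cball 0 1" "\<lambda>w. ball w (r w)"])
      (use r in auto)
  define K where "K = (\<Sum>w\<in>D. 2 * norm (R w))"
  have K: "norm (R z) \<le> K" if z: "cmod z \<le> 1" for z
  proof -
    obtain w where w: "w \<in> D" "z \<in> ball w (r w)" using D(3) z by auto
    then have "norm (R z) \<le> 2 * norm (R w)" using D(1) z by (intro loc) auto
    also have "\<dots> \<le> K"
      unfolding K_def using w D(2) by (intro member_le_sum) auto
    finally show ?thesis .
  qed
  then have "0 \<le> K" using norm_ge_zero order_trans by (metis norm_zero zero_le_one)
  show ?thesis
  proof (rule that[of R "max K (norm h * K * K)"])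
    fix z w :: complex assume zw: "cmod z \<le> 1" "cmod w \<le> 1"
    have "norm (R z - R w) \<le> cmod (z - w) * norm h * norm (R z) * norm (R w)"
      by (rule resolvent[OF zw])
    also have "\<dots> \<le> cmod (z - w) * norm h * K * K"
      using K zw \<open>0 \<le> K\<close> by (intro mult_mono) auto
    also have "\<dots> = norm h * K * K * cmod (z - w)" by (simp add: mult_ac)
    also have "\<dots> \<le> max K (norm h * K * K) * cmod (z - w)"
      by (intro mult_right_mono) auto
    finally show "norm (R z - R w) \<le> max K (norm h * K * K) * cmod (z - w)" .
  qed (use R K in \<open>auto simp: le_max_iff_disj\<close>)
qed

text \<open>
  The inverse of \<open>1 - (z h) ^ 2 ^ n\<close> is the average of the inverses of \<open>1 - \<zeta> z h\<close> over the
  \<open>2 ^ n\<close>-th roots of unity \<open>\<zeta>\<close>, so it inherits bounds that do not depend on \<open>n\<close>.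
\<close>
lemma resolvent_dyadic_power:
  fixes h :: "'a::unital_cstar_algebra"
  assumes R: "\<And>z. cmod z \<le> 1 \<Longrightarrow> (1 - z *\<^sub>C h) * R z = 1"
    "\<And>z. cmod z \<le> 1 \<Longrightarrow> norm (R z) \<le> K"
    "\<And>z w. cmod z \<le> 1 \<Longrightarrow> cmod w \<le> 1 \<Longrightarrow> norm (R z - R w) \<le> K * cmod (z - w)"
  shows "\<exists>S. \<forall>z. cmod z \<le> 1 \<longrightarrow> (1 - (z *\<^sub>C h) ^ 2 ^ n) * S z = 1 \<and> norm (S z) \<le> K \<and>
    (\<forall>w. cmod w \<le> 1 \<longrightarrow> norm (S z - S w) \<le> K * cmod (z - w))"
proof (induction n)
  case 0
  show ?case by (rule exI[of _ R]) (use R in simp)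
next
  case (Suc n)
  from Suc.IH obtain S where S: "\<And>z. cmod z \<le> 1 \<Longrightarrow> (1 - (z *\<^sub>C h) ^ 2 ^ n) * S z = 1"
    "\<And>z. cmod z \<le> 1 \<Longrightarrow> norm (S z) \<le> K"
    "\<And>z w. cmod z \<le> 1 \<Longrightarrow> cmod w \<le> 1 \<Longrightarrow> norm (S z - S w) \<le> K * cmod (z - w)"
    by blast
  \<comment> \<open>Passing from z to \<zeta> z flips the sign of X below; averaging right inverses
    of 1 - X and 1 + X gives one of 1 - X^2.\<close>
  define \<zeta> where "\<zeta> = cis (pi / 2 ^ n)"
  have norm_\<zeta>: "cmod (\<zeta> * z) = cmod z" for z by (simp add: \<zeta>_def norm_mult)
  have power_\<zeta>: "\<zeta> ^ 2 ^ n = -1" by (simp add: \<zeta>_def DeMoivre)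
  define T where "T z = (1/2) *\<^sub>R (S z + S (\<zeta> * z))" for z
  show ?case
  proof (intro exI[of _ T] allI impI conjI)
    fix z assume z: "cmod z \<le> 1"
    define X where "X = (z *\<^sub>C h) ^ 2 ^ n"
    have sq: "(z *\<^sub>C h) ^ 2 ^ Suc n = X * X"
      by (simp add: X_def power_add[symmetric] mult_2)
    have "((\<zeta> * z) *\<^sub>C h) ^ 2 ^ n = - X"
      by (simp add: X_def power_scaleC power_mult_distrib power_\<zeta> scaleC_minus_left)
    then have X: "(1 - X) * S z = 1" "(1 + X) * S (\<zeta> * z) = 1"
      using S(1)[of z] S(1)[of "\<zeta> * z"] z norm_\<zeta>[of z] by (simp_all add: X_def)
    have "(1 - X * X) * S z = (1 + X) * ((1 - X) * S z)"
      "(1 - X * X) * S (\<zeta> * z) = (1 - X) * ((1 + X) * S (\<zeta> * z))"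
      by (simp_all add: algebra_simps)
    then have "(1 - X * X) * T z = (1/2) *\<^sub>R ((1 + X) + (1 - X))"
      by (simp only: X T_def mult_scaleR_right distrib_left mult_1_right)
    then have "(1 - X * X) * T z = 1"
      by (simp add: scaleR_2[symmetric])
    then show "(1 - (z *\<^sub>C h) ^ 2 ^ Suc n) * T z = 1"
      by (simp only: sq)
    show "norm (T z) \<le> K"
      using norm_triangle_ineq[of "S z" "S (\<zeta> * z)"] S(2)[of z] S(2)[of "\<zeta> * z"] z norm_\<zeta>[of z]
      by (simp add: T_def)
    fix w assume w: "cmod w \<le> 1"
    have "T z - T w = (1/2) *\<^sub>R ((S z - S w) + (S (\<zeta> * z) - S (\<zeta> * w)))"
      by (simp add: T_def algebra_simps)
    then have "norm (T z - T w) \<le> (1/2) * (norm (S z - S w) + norm (S (\<zeta> * z) - S (\<zeta> * w)))"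
      using norm_triangle_ineq[of "S z - S w" "S (\<zeta> * z) - S (\<zeta> * w)"] by simp
    moreover have "norm (S (\<zeta> * z) - S (\<zeta> * w)) \<le> K * cmod (z - w)"
      using S(3)[of "\<zeta> * z" "\<zeta> * w"] z w norm_\<zeta> by (simp add: right_diff_distrib[symmetric])
    ultimately show "norm (T z - T w) \<le> K * cmod (z - w)"
      using S(3)[OF z w] by simp
  qed
qed

text \<open>Takes the place of the spectral radius formula. For fixed l < 1 the powers of l h tend
  to 0, so the resolvent S l is close to 1; the Lipschitz constant is the same for all exponents, so
  S 1 is close to 1 as well, which makes the power of \<open>h\<close> small.\<close>

lemma dyadic_power_norm_less_one:
  fixes h :: "'a::unital_cstar_algebra"
  assumes "\<And>z. cmod z \<le> 1 \<Longrightarrow> invertible_element (1 - z *\<^sub>C h)" and h: "norm h \<le> 1"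
  shows "\<exists>n. norm (h ^ 2 ^ n) < 1"
proof -
  obtain R K where R: "\<And>z. cmod z \<le> 1 \<Longrightarrow> (1 - z *\<^sub>C h) * R z = 1"
    "\<And>z. cmod z \<le> 1 \<Longrightarrow> norm (R z) \<le> K"
    "\<And>z w. cmod z \<le> 1 \<Longrightarrow> cmod w \<le> 1 \<Longrightarrow> norm (R z - R w) \<le> K * cmod (z - w)"
    by (rule resolvent_lipschitz_on_disc[OF assms(1)]) blast+
  have K: "0 \<le> K" using order_trans[OF norm_ge_zero R(2)[of 0]] by simp
  \<comment> \<open>Close enough to 1 that the Lipschitz bound costs at most 1/4. The same number 1
    / (4 * (K + 1)) is the threshold for \<open>l ^ N\<close>, making \<open>l ^ N * K\<close> less
    than 1/4.\<close>
  define l where "l = 1 - 1 / (4 * (K + 1))"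
  have l: "0 < l" "l < 1" "K * (1 - l) \<le> 1 / 4"
    using K by (simp_all add: l_def divide_simps)
  have "(\<lambda>n. l ^ n) \<longlonglongrightarrow> 0" using l by (intro LIMSEQ_realpow_zero) auto
  then have "\<forall>\<^sub>F n in sequentially. l ^ n < 1 / (4 * (K + 1))"
    by (rule order_tendstoD) (use K in simp)
  then obtain n0 where n0: "\<And>n. n \<ge> n0 \<Longrightarrow> l ^ n < 1 / (4 * (K + 1))"
    by (auto simp: eventually_sequentially)
  define N where "N = (2::nat) ^ n0"
  have "n0 \<le> N" unfolding N_def by (rule less_imp_le) (rule less_exp)
  obtain S where S: "\<And>z. cmod z \<le> 1 \<Longrightarrow> (1 - (z *\<^sub>C h) ^ N) * S z = 1"
    "\<And>z. cmod z \<le> 1 \<Longrightarrow> norm (S z) \<le> K"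
    "\<And>z w. cmod z \<le> 1 \<Longrightarrow> cmod w \<le> 1 \<Longrightarrow> norm (S z - S w) \<le> K * cmod (z - w)"
    using resolvent_dyadic_power[of h R K n0, OF R] unfolding N_def by blast
  have "norm (S 1 - S (of_real l)) \<le> K * cmod (1 - of_real l)"
    by (rule S(3)) (use l in auto)
  also have "cmod (1 - of_real l) = 1 - l"
    using l by (metis abs_of_pos diff_gt_0_iff_gt norm_of_real of_real_1 of_real_diff)
  finally have near1: "norm (S 1 - S (of_real l)) \<le> 1 / 4" using l by simp
  have "S (of_real l) - 1 = (of_real l *\<^sub>C h) ^ N * S (of_real l)"
    using S(1)[of "of_real l"] l by (simp add: algebra_simps)
  then have "norm (S (of_real l) - 1) \<le> norm ((of_real l *\<^sub>C h) ^ N) * norm (S (of_real l))"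
    by (simp add: norm_mult_ineq)
  also have "\<dots> \<le> l ^ N * K"
  proof (rule mult_mono)
    have "norm ((of_real l *\<^sub>C h) ^ N) = l ^ N * norm (h ^ N)"
      using l by (simp add: power_scaleC norm_scaleC norm_power)
    also have "norm (h ^ N) \<le> 1"
      using norm_power_le[of h N] power_le_one[OF norm_ge_zero h, of N] by linarith
    finally show "norm ((of_real l *\<^sub>C h) ^ N) \<le> l ^ N" using l by (simp add: mult_left_mono)
  qed (use S(2) l K in auto)
  also have "\<dots> \<le> 1 / (4 * (K + 1)) * K"
    using n0[OF \<open>n0 \<le> N\<close>] K by (intro mult_right_mono) auto
  also have "\<dots> < 1 / 4" using K by (simp add: divide_simps)
  finally have near2: "norm (S (of_real l) - 1) < 1 / 4" .
  define e where "e = S 1 - 1"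
  have e: "norm e < 1 / 2"
    using near1 near2 norm_triangle_ineq[of "S 1 - S (of_real l)" "S (of_real l) - 1"]
    by (simp add: e_def)
  have he: "h ^ N = e - h ^ N * e"
    using S(1)[of 1] by (simp add: e_def scaleC_one algebra_simps)
  have "norm (h ^ N) \<le> norm e + norm (h ^ N) * norm e"
    by (subst he) (rule order_trans[OF norm_triangle_ineq4 add_left_mono[OF norm_mult_ineq]])
  also have "\<dots> \<le> norm e + norm (h ^ N) * (1 / 2)"
    using e by (intro add_left_mono mult_left_mono) auto
  finally have "norm (h ^ N) < 1" using e by simp
  then show ?thesis unfolding N_def by blast
qed

text \<open>Otherwise no w with |w| at least 1 is in the spectrum: |w| > 1 is excluded by the norm,
  nonreal w by self-adjointness, and 1 and -1 by assumption. With z = 1/w this covers the unit disc,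
  so some dyadic power has norm below 1, although all have norm 1.\<close>

lemma self_adjoint_norm_one_not_invertible:
  assumes x: "self_adjoint (x::'a::unital_cstar_algebra)" and n: "norm x = 1"
  shows "\<not> invertible_element (1 - x) \<or> \<not> invertible_element (1 + x)"
proof (rule ccontr)
  assume "\<not> ?thesis"
  then have inv: "invertible_element (1 - x)" "invertible_element (1 + x)" by auto
  have "invertible_element (1 - z *\<^sub>C x)" if z: "cmod z \<le> 1" for z
  proof (cases "z = 0")
    case True
    then show ?thesis by (auto intro: invertible_elementI)
  next
    case False
    define w where "w = inverse z"
    have w: "cmod w \<ge> 1"
      using z False by (simp add: w_def norm_inverse norm_divide divide_simps)
    have "invertible_element (w *\<^sub>C 1 - x)"
    proof (cases "cmod w > 1")
      case True
      then show ?thesis using n by (intro invertible_element_scaleC_one_diff) simp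
    next
      case False
      then have w1: "cmod w = 1" using w by simp
      show ?thesis
      proof (cases "Im w = 0")
        case True
        then have "\<bar>Re w\<bar> = 1" using w1 by (simp add: cmod_def)
        then have "w = 1 \<or> w = -1" using True by (auto simp: complex_eq_iff abs_if split: if_splits)
        moreover have "invertible_element ((- 1) *\<^sub>C (1 + x))"
          by (rule invertible_element_scaleC[OF _ inv(2)]) simp
        ultimately show ?thesis using inv(1) by (auto simp: scaleC_simps)
      qed (rule invertible_element_nonreal[OF x])
    qed
    then have "invertible_element (z *\<^sub>C (w *\<^sub>C 1 - x))"
      using False by (intro invertible_element_scaleC)
    then show ?thesis using False by (simp add: w_def scaleC_simps)
  qed
  then have "\<exists>k. norm (x ^ 2 ^ k) < 1"
    using n by (intro dyadic_power_norm_less_one) simp_all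
  then show False by (simp add: norm_self_adjoint_power[OF x] n)
qed

lemma self_adjoint_norm_le:
  assumes x: "self_adjoint (x::'a::unital_cstar_algebra)" and t: "0 \<le> t"
    and inv: "\<And>s. t < s \<Longrightarrow> invertible_element (s *\<^sub>R 1 - x)"
      "\<And>s. t < s \<Longrightarrow> invertible_element (s *\<^sub>R 1 + x)"
  shows "norm x \<le> t"
proof (rule ccontr)
  assume "\<not> norm x \<le> t"
  then have n: "t < norm x" "0 < norm x" using t by auto
  define y where "y = (1 / norm x) *\<^sub>R x"
  have "(1 / norm x) *\<^sub>R (norm x *\<^sub>R 1 - x) = 1 - y" "(1 / norm x) *\<^sub>R (norm x *\<^sub>R 1 + x) = 1 + y"
    using n(2) by (simp_all add: y_def algebra_simps)
  moreover have "invertible_element ((1 / norm x) *\<^sub>R (norm x *\<^sub>R 1 - x))"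
    "invertible_element ((1 / norm x) *\<^sub>R (norm x *\<^sub>R 1 + x))"
    using inv[OF n(1)] n(2) by (simp_all add: invertible_element_scaleR_iff)
  ultimately have "invertible_element (1 - y)" "invertible_element (1 + y)" by simp_all
  moreover have "self_adjoint y" "norm y = 1"
    using n(2) x by (auto simp: y_def intro: self_adjoint_intros)
  ultimately show False using self_adjoint_norm_one_not_invertible by blast
qed

section \<open>The positive cone\<close>

text \<open>The spectrum of a self-adjoint element is real, so only the negative reals -s have to be
  excluded. This is the form of positivity used from here on.\<close>

lemma positive_element_iff:
  "positive_element x \<longleftrightarrow> self_adjoint x \<and> (\<forall>s>0. invertible_element (s *\<^sub>R 1 + x))"
proof (cases "self_adjoint x")
  case x: True
  have neg: "(of_real (- s)) *\<^sub>C 1 - x = (- 1) *\<^sub>R (s *\<^sub>R 1 + x)" for s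
    by (simp only: scaleR_scaleC[symmetric]) simp
  have "positive_element x \<longleftrightarrow> (\<forall>z. z \<in> spectrum x \<longrightarrow> z \<in> of_real ` {0..})"
    using x by (auto simp: positive_element_def)
  also have "\<dots> \<longleftrightarrow> (\<forall>s>0. of_real (- s) \<notin> spectrum x)"
  proof (intro iffI allI impI)
    fix s :: real assume "\<forall>z. z \<in> spectrum x \<longrightarrow> z \<in> of_real ` {0..}" "s > 0"
    moreover have "complex_of_real (- s) \<notin> of_real ` {0..}"
      using \<open>s > 0\<close> by (auto simp del: of_real_minus)
    ultimately show "of_real (- s) \<notin> spectrum x" by blast
  next
    fix z assume *: "\<forall>s>0. complex_of_real (- s) \<notin> spectrum x" and z: "z \<in> spectrum x"
    have "Im z = 0" using z invertible_element_nonreal[OF x] by (auto simp: spectrum_def)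
    then have zr: "z = of_real (Re z)" by (simp add: complex_eq_iff)
    moreover have "Re z \<ge> 0"
    proof (rule ccontr)
      assume "\<not> Re z \<ge> 0"
      then show False using *[rule_format, of "- Re z"] z zr by simp
    qed
    ultimately show "z \<in> of_real ` {0..}" by (metis atLeast_iff imageI)
  qed
  also have "\<dots> \<longleftrightarrow> (\<forall>s>0. invertible_element (s *\<^sub>R 1 + x))"
    unfolding spectrum_def mem_Collect_eq neg by (simp only: invertible_element_scaleR_iff) simp
  finally show ?thesis using x by simp
qed (simp add: positive_element_def)

lemma positive_elementI:
  "self_adjoint x \<Longrightarrow> (\<And>s. 0 < s \<Longrightarrow> invertible_element (s *\<^sub>R 1 + x)) \<Longrightarrow> positive_element x"
  by (simp add: positive_element_iff)

lemma positive_element_self_adjoint: "positive_element x \<Longrightarrow> self_adjoint x"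
  by (simp add: positive_element_def)

lemma positive_element_invertible:
  "positive_element (x - s *\<^sub>R 1) \<Longrightarrow> 0 < s \<Longrightarrow> invertible_element x"
  using positive_element_iff[of "x - s *\<^sub>R 1"] by force

text \<open>Together with \<open>positive_element_if_norm_diff_le\<close>, this expresses positivity
  as a norm inequality, so that sums can be handled by the triangle inequality.\<close>

lemma positive_element_norm_diff_le:
  assumes x: "positive_element x" and t: "norm x \<le> t"
  shows "norm (t *\<^sub>R 1 - x) \<le> t"
proof (rule self_adjoint_norm_le)
  have t0: "0 \<le> t" using t norm_ge_zero order_trans by blast
  then show "0 \<le> t" .
  fix s assume s: "t < s"
  have "invertible_element ((s - t) *\<^sub>R 1 + x)"
    using x s by (simp add: positive_element_iff)
  then show "invertible_element (s *\<^sub>R 1 - (t *\<^sub>R 1 - x))"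
    by (simp add: algebra_simps)
  have "invertible_element ((s + t) *\<^sub>R 1 - x)"
    using s t t0 norm_ge_zero[of x] by (intro invertible_element_scaleR_one_diff) linarith
  then show "invertible_element (s *\<^sub>R 1 + (t *\<^sub>R 1 - x))"
    by (simp add: algebra_simps)
qed (intro self_adjoint_intros positive_element_self_adjoint x)

lemma positive_element_if_norm_diff_le:
  assumes x: "self_adjoint x" and t: "norm (t *\<^sub>R 1 - x) \<le> t"
  shows "positive_element x"
proof (rule positive_elementI[OF x])
  fix s :: real assume "0 < s"
  then have "invertible_element ((s + t) *\<^sub>R 1 - (t *\<^sub>R 1 - x))"
    using t norm_ge_zero[of "t *\<^sub>R 1 - x"] by (intro invertible_element_scaleR_one_diff) linarith
  then show "invertible_element (s *\<^sub>R 1 + x)" by (simp add: algebra_simps)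
qed

lemma positive_element_scaleR_one_diff:
  assumes "self_adjoint x" "norm x \<le> t"
  shows "positive_element (t *\<^sub>R 1 - x)"
  by (rule positive_element_if_norm_diff_le[where t=t]) (use assms in \<open>auto intro: self_adjoint_intros\<close>)

lemma positive_element_add:
  assumes x: "positive_element x" and y: "positive_element y"
  shows "positive_element (x + y)"
proof (rule positive_element_if_norm_diff_le)
  define t where "t = max (norm x) (norm y)"
  have sum: "(2 * t) *\<^sub>R 1 - (x + y) = (t *\<^sub>R 1 - x) + (t *\<^sub>R 1 - y)"
    by (simp add: algebra_simps flip: scaleR_2)
  have "norm (t *\<^sub>R 1 - x) \<le> t" "norm (t *\<^sub>R 1 - y) \<le> t"
    using x y by (auto simp: t_def intro!: positive_element_norm_diff_le)
  then show "norm ((2 * t) *\<^sub>R 1 - (x + y)) \<le> 2 * t"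
    using norm_triangle_ineq[of "t *\<^sub>R 1 - x" "t *\<^sub>R 1 - y"]
    unfolding sum by simp
qed (intro self_adjoint_intros positive_element_self_adjoint x y)

lemma positive_element_scaleR:
  assumes x: "positive_element x" and r: "0 < r"
  shows "positive_element (r *\<^sub>R x)"
proof (rule positive_elementI)
  fix s :: real assume "0 < s"
  then have "invertible_element (r *\<^sub>R ((s / r) *\<^sub>R 1 + x))"
    using x r by (simp add: invertible_element_scaleR_iff positive_element_iff)
  then show "invertible_element (s *\<^sub>R 1 + r *\<^sub>R x)" using r by (simp add: algebra_simps)
qed (intro self_adjoint_intros positive_element_self_adjoint x)

lemma positive_element_square:
  assumes x: "self_adjoint x"
  shows "positive_element (x * x)"
proof (rule positive_elementI)
  show "self_adjoint (x * x)" using self_adjoint_conjugate[OF self_adjoint_one x] by simp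
  fix s :: real assume s: "0 < s"
  have "complex_of_real (- s) \<notin> of_real ` {0..}" using s by (auto simp del: of_real_minus)
  from invertible_element_diff_square[OF x this]
  have "invertible_element ((- 1) *\<^sub>R ((- s) *\<^sub>R 1 - x * x))"
    by (simp only: scaleR_scaleC[symmetric] invertible_element_scaleR_iff)
  then show "invertible_element (s *\<^sub>R 1 + x * x)" by (simp add: algebra_simps)
qed

text \<open>The margin comes from the inverse e of c: below it, c^2 - r = c (1 - r e^2) c, and the
  middle factor has a Neumann series.\<close>

lemma positive_element_square_diff:
  assumes c: "self_adjoint c" "invertible_element c"
  shows "\<exists>\<epsilon>>0. positive_element (c * c - \<epsilon> *\<^sub>R 1)"
proof -
  obtain e where e: "c * e = 1" "e * c = 1" using c(2) by (auto simp: invertible_element_def)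
  define \<epsilon> where "\<epsilon> = 1 / (norm (e * e) + 1)"
  have \<epsilon>: "0 < \<epsilon>" by (simp add: \<epsilon>_def add_nonneg_pos)
  have "positive_element (c * c - \<epsilon> *\<^sub>R 1)"
  proof (rule positive_elementI)
    have sq: "positive_element (c * c)" by (rule positive_element_square[OF c(1)])
    then show "self_adjoint (c * c - \<epsilon> *\<^sub>R 1)"
      by (intro self_adjoint_intros positive_element_self_adjoint)
    fix s :: real assume s: "0 < s"
    consider "s > \<epsilon>" | "s \<le> \<epsilon>" by linarith
    then have "invertible_element ((s - \<epsilon>) *\<^sub>R 1 + c * c)"
    proof cases
      case 1
      then show ?thesis using sq by (simp add: positive_element_iff)
    next
      case 2
      have "norm ((\<epsilon> - s) *\<^sub>R (e * e)) = (\<epsilon> - s) * norm (e * e)" using 2 by simp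
      also have "\<dots> \<le> \<epsilon> * norm (e * e)" using s by (intro mult_right_mono) auto
      also have "\<dots> < 1" by (simp add: \<epsilon>_def divide_simps add_nonneg_pos)
      finally have "invertible_element (1 - (\<epsilon> - s) *\<^sub>R (e * e))"
        by (rule invertible_element_one_diff)
      then have "invertible_element (c * (1 - (\<epsilon> - s) *\<^sub>R (e * e)) * c)"
        using c(2) by (simp add: invertible_element_conjugate_iff)
      moreover have "c * (e * e) * c = 1" by (metis e mult.assoc mult_1_left)
      then have "c * (1 - (\<epsilon> - s) *\<^sub>R (e * e)) * c = c * c - (\<epsilon> - s) *\<^sub>R 1"
        by (simp only: right_diff_distrib left_diff_distrib mult_scaleR_left mult_scaleR_right mult_1_right)
      ultimately have "invertible_element (c * c - (\<epsilon> - s) *\<^sub>R 1)" by (simp only:)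
      then show ?thesis by (simp add: algebra_simps)
    qed
    then show "invertible_element (s *\<^sub>R 1 + (c * c - \<epsilon> *\<^sub>R 1))"
      by (simp add: algebra_simps)
  qed
  with \<epsilon> show ?thesis by blast
qed

text \<open>With e the inverse of c, s + c x c = c (s e^2 + x) c. The middle factor is at least a
  positive multiple of 1, because e^2 is.\<close>

lemma positive_element_conjugate:
  assumes x: "positive_element x" and c: "self_adjoint c" "invertible_element c"
  shows "positive_element (c * x * c)"
proof (rule positive_elementI)
  fix s :: real assume s: "0 < s"
  obtain e where e: "c * e = 1" "e * c = 1" using c(2) by (auto simp: invertible_element_def)
  then have "self_adjoint e" "invertible_element e"
    using self_adjoint_inverse[OF c(1)] by (auto intro: invertible_elementI)
  then obtain \<epsilon> where \<epsilon>: "0 < \<epsilon>" "positive_element (e * e - \<epsilon> *\<^sub>R 1)"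
    using positive_element_square_diff by blast
  have "positive_element (s *\<^sub>R (e * e - \<epsilon> *\<^sub>R 1) + x)"
    by (intro positive_element_add positive_element_scaleR \<epsilon> s x)
  then have "positive_element ((s *\<^sub>R (e * e) + x) - (s * \<epsilon>) *\<^sub>R 1)"
    by (simp add: algebra_simps)
  then have "invertible_element (s *\<^sub>R (e * e) + x)"
    using s \<epsilon> by (intro positive_element_invertible[where s = "s * \<epsilon>"]) auto
  then have "invertible_element (c * (s *\<^sub>R (e * e) + x) * c)"
    using c(2) by (simp add: invertible_element_conjugate_iff)
  moreover have "c * (e * e) * c = 1" by (metis e mult.assoc mult_1_left)
  then have "c * (s *\<^sub>R (e * e) + x) * c = s *\<^sub>R 1 + c * x * c"
    by (simp add: distrib_left distrib_right)
  ultimately show "invertible_element (s *\<^sub>R 1 + c * x * c)" by simp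
qed (intro self_adjoint_intros positive_element_self_adjoint x c)

section \<open>Elements with equal spectra\<close>

text \<open>By \<open>H\<close>, \<open>A\<close> and \<open>B\<close> have the same scalar upper
  bounds N. The two positivity hypotheses send such a bound to (N + \<delta>) / (1 + \<kappa>), a
  contraction with fixed point 2 \<beta> \<delta>. So the infimum of the bounds cannot exceed this
  value.\<close>

lemma equal_spectrum_upper_bound:
  fixes A B C :: "'a::unital_cstar_algebra"
  assumes sa: "self_adjoint A" "self_adjoint B"
    and H: "\<And>s::real. invertible_element (s *\<^sub>R 1 - A) \<longleftrightarrow> invertible_element (s *\<^sub>R 1 - B)"
    and pos: "positive_element (A - B - (1/2) *\<^sub>R C + \<delta> *\<^sub>R 1)" "positive_element (\<beta> *\<^sub>R C - B)"
    and "0 < \<beta>" "0 \<le> \<delta>" and t: "2 * \<beta> * \<delta> < t"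
  shows "positive_element (t *\<^sub>R 1 - A)"
proof (rule ccontr)
  assume not: "\<not> positive_element (t *\<^sub>R 1 - A)"
  define Q where "Q = {N. positive_element (N *\<^sub>R 1 - A)}"
  have Q_eq: "positive_element (N *\<^sub>R 1 - A) \<longleftrightarrow> positive_element (N *\<^sub>R 1 - B)" for N
  proof -
    have shift: "s *\<^sub>R 1 + (N *\<^sub>R 1 - X) = (s + N) *\<^sub>R 1 - X" for s and X :: 'a
      by (simp add: algebra_simps)
    show ?thesis using sa unfolding positive_element_iff shift H by (simp add: self_adjoint_intros)
  qed
  \<comment> \<open>With \<kappa> \<beta> = 1/2 the terms in \<open>C\<close> cancel when the
    inequalities are added.\<close>
  define \<kappa> where "\<kappa> = 1 / (2 * \<beta>)"
  have \<kappa>: "0 < \<kappa>" "\<kappa> * \<beta> = 1 / 2" "\<kappa> * t > \<delta>"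
    using \<open>0 < \<beta>\<close> t by (simp_all add: \<kappa>_def field_simps)
  have step: "(N + \<delta>) / (1 + \<kappa>) \<in> Q" if "N \<in> Q" for N
  proof -
    have "positive_element ((N *\<^sub>R 1 - A) + (A - B - (1/2) *\<^sub>R C + \<delta> *\<^sub>R 1) + \<kappa> *\<^sub>R (\<beta> *\<^sub>R C - B))"
      using that by (intro positive_element_add positive_element_scaleR pos \<kappa>) (simp add: Q_def)
    also have "(N *\<^sub>R 1 - A) + (A - B - (1/2) *\<^sub>R C + \<delta> *\<^sub>R 1) + \<kappa> *\<^sub>R (\<beta> *\<^sub>R C - B)
        = (N + \<delta>) *\<^sub>R 1 - (1 + \<kappa>) *\<^sub>R B"
      by (simp add: scaleR_diff_right \<kappa>(2)) (simp add: algebra_simps)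
    finally have "positive_element ((1 / (1 + \<kappa>)) *\<^sub>R ((N + \<delta>) *\<^sub>R 1 - (1 + \<kappa>) *\<^sub>R B))"
      using \<kappa> by (intro positive_element_scaleR) auto
    then show ?thesis
      using \<kappa> by (simp add: Q_def Q_eq scaleR_diff_right)
  qed
  have lower: "t \<le> N" if "N \<in> Q" for N
  proof (rule ccontr)
    assume "\<not> t \<le> N"
    then have "positive_element ((N *\<^sub>R 1 - A) + (t - N) *\<^sub>R 1)"
      using that self_adjoint_one positive_element_square[OF self_adjoint_one, where 'a='a]
      by (intro positive_element_add positive_element_scaleR) (simp_all add: Q_def)
    then have "positive_element (t *\<^sub>R 1 - A)" by (simp add: algebra_simps)
    with not show False by contradiction
  qed
  have "norm A \<in> Q" using sa by (simp add: Q_def positive_element_scaleR_one_diff)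
  then have ne: "Q \<noteq> {}" by blast
  have bdd: "bdd_below Q" using lower by (rule bdd_belowI)
  have "t \<le> Inf Q" using ne lower by (rule cInf_greatest)
  then have "\<kappa> * t \<le> \<kappa> * Inf Q" using \<kappa> by (intro mult_left_mono) auto
  \<comment> \<open>This leaves room for a bound N so near the infimum that \<open>step\<close> maps
    it below the infimum.\<close>
  then have "Inf Q < Inf Q * (1 + \<kappa>) - \<delta>" using \<kappa>(3) by (simp add: algebra_simps)
  then obtain N where N: "N \<in> Q" "N < Inf Q * (1 + \<kappa>) - \<delta>"
    using cInf_lessD[OF ne] by blast
  have "(N + \<delta>) / (1 + \<kappa>) < Inf Q" using N(2) \<kappa> by (simp add: divide_simps)
  moreover have "Inf Q \<le> (N + \<delta>) / (1 + \<kappa>)" by (rule cInf_lower[OF step[OF N(1)] bdd])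
  ultimately show False by simp
qed

text \<open>Scalar inequality (v - q) v^n + q^(n+1) \<ge> 0 for v = u^2. The induction uses (v - q)
  v^(n+1) + q^(n+2) = (v - q)^2 v^n + q ((v - q) v^n + q^(n+1)), whose first term is the square of
  (v - q) u^n.\<close>

lemma positive_element_power_diff:
  assumes u: "self_adjoint u" and q: "0 < q"
  shows "positive_element ((u * u - q *\<^sub>R 1) * (u * u) ^ n + q ^ Suc n *\<^sub>R 1)"
proof (induction n)
  case 0
  then show ?case using positive_element_square[OF u] by simp
next
  case (Suc n)
  define v where "v = u * u"
  define w where "w = (v - q *\<^sub>R 1) * u ^ n"
  have uv: "u ^ n * v = v * u ^ n"
    unfolding v_def by (rule power_commuting_commutes) (simp add: mult.assoc)
  have vn: "v ^ n = u ^ n * u ^ n"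
    by (simp add: v_def power2_eq_square[symmetric] power_mult[symmetric] power_add[symmetric] mult_2 mult_2_right)
  have comm: "u ^ n * (v - q *\<^sub>R 1) = (v - q *\<^sub>R 1) * u ^ n"
    by (simp add: algebra_simps uv)
  have "self_adjoint v" using positive_element_square[OF u] positive_element_self_adjoint v_def by metis
  then have "self_adjoint (v - q *\<^sub>R 1)" "self_adjoint (u ^ n)"
    using u by (auto intro: self_adjoint_intros)
  then have "self_adjoint w" by (simp add: w_def self_adjoint_def star_mult comm)
  then have "positive_element (w * w + q *\<^sub>R ((v - q *\<^sub>R 1) * v ^ n + q ^ Suc n *\<^sub>R 1))"
    using positive_element_add[OF positive_element_square positive_element_scaleR[OF Suc.IH q]]
    unfolding v_def by blast
  also have "w * w = (v - q *\<^sub>R 1) * (u ^ n * (v - q *\<^sub>R 1)) * u ^ n" by (simp add: w_def mult.assoc)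
  also have "\<dots> = (v - q *\<^sub>R 1) * (v - q *\<^sub>R 1) * v ^ n" by (simp add: comm vn mult.assoc)
  also have "(v - q *\<^sub>R 1) * (v - q *\<^sub>R 1) * v ^ n + q *\<^sub>R ((v - q *\<^sub>R 1) * v ^ n + q ^ Suc n *\<^sub>R 1)
      = (v - q *\<^sub>R 1) * v ^ Suc n + q ^ Suc (Suc n) *\<^sub>R 1"
    by (simp add: algebra_simps)
  finally show ?case by (simp only: v_def)
qed

text \<open>One half of spectral mapping for powers: r - v divides r^n - v^n, with a cofactor
  commuting with v.\<close>

lemma invertible_element_diff_if_power_diff:
  fixes v :: "'a::unital_cstar_algebra"
  assumes "invertible_element (r ^ n *\<^sub>R 1 - v ^ n)"
  shows "invertible_element (r *\<^sub>R 1 - v)"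
proof -
  have "\<exists>w. v * w = w * v \<and> r ^ n *\<^sub>R 1 - v ^ n = (r *\<^sub>R 1 - v) * w"
  proof (induction n)
    case 0
    show ?case by (rule exI[of _ 0]) simp
  next
    case (Suc n)
    then obtain w where w: "v * w = w * v" "r ^ n *\<^sub>R 1 - v ^ n = (r *\<^sub>R 1 - v) * w" by blast
    have "r ^ Suc n *\<^sub>R 1 - v ^ Suc n = r ^ n *\<^sub>R (r *\<^sub>R 1 - v) + (r ^ n *\<^sub>R 1 - v ^ n) * v"
      by (simp add: algebra_simps power_commutes)
    also have "\<dots> = (r *\<^sub>R 1 - v) * (r ^ n *\<^sub>R 1 + w * v)"
      unfolding w(2) by (simp add: algebra_simps)
    finally have "r ^ Suc n *\<^sub>R 1 - v ^ Suc n = (r *\<^sub>R 1 - v) * (r ^ n *\<^sub>R 1 + w * v)" .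
    moreover have "v * (r ^ n *\<^sub>R 1 + w * v) = (r ^ n *\<^sub>R 1 + w * v) * v"
    proof -
      have "v * (w * v) = w * v * v" by (metis w(1) mult.assoc)
      then show ?thesis by (simp only: distrib_left distrib_right) simp
    qed
    ultimately show ?case by blast
  qed
  then obtain w where w: "v * w = w * v" "r ^ n *\<^sub>R 1 - v ^ n = (r *\<^sub>R 1 - v) * w" by blast
  then have "(r *\<^sub>R 1 - v) * w = w * (r *\<^sub>R 1 - v)"
    by (simp only: left_diff_distrib right_diff_distrib) simp
  then show ?thesis using assms w(2) by (metis invertible_element_factor)
qed

text \<open>Phrased as invertibility so that it applies to both signs of the normalised difference,
  against \<open>self_adjoint_norm_one_not_invertible\<close>.\<close>

lemma invertible_element_one_minus_difference:
  fixes a b :: "'a::unital_cstar_algebra"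
  assumes sa: "self_adjoint a" "self_adjoint b"
    and H: "\<And>c (s::real). self_adjoint c \<Longrightarrow> invertible_element c \<Longrightarrow>
      invertible_element (s *\<^sub>R 1 - c * a * c) \<longleftrightarrow> invertible_element (s *\<^sub>R 1 - c * b * c)"
    and d: "norm (a - b) = 1"
  shows "invertible_element (1 - (a - b))"
proof -
  define d where "d = a - b"
  \<comment> \<open>The shift 2 exceeds \<open>norm d\<close>, so \<open>u\<close>, and later
    \<open>c\<close>, is invertible.\<close>
  define u where "u = 2 *\<^sub>R 1 + d"
  define v where "v = u * u"
  define \<alpha> where "\<alpha> = norm a + 1"
  define \<beta> where "\<beta> = norm b + 1"
  have \<alpha>\<beta>: "0 < \<alpha>" "0 < \<beta>" by (simp_all add: \<alpha>_def \<beta>_def add_nonneg_pos)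
  \<comment> \<open>Collects the final estimate \<open>C\<close> \<le> (4 \<alpha> + 4 \<beta> + 6)
    \<delta> = L * 7^(2k). As 49/81 = (7/9)^2, a large k puts this below 9^(2k).\<close>
  define L where "L = (4 * \<alpha> + 4 * \<beta> + 6) * (7/4)"
  have L: "0 < L" using \<alpha>\<beta> by (simp add: L_def)
  obtain k where "(49/81) ^ k < 1 / L"
    using real_arch_pow_inv[of "1 / L" "49/81"] L by auto
  then have k: "L * 7 ^ (2 * k) < 9 ^ (2 * k)"
    using L unfolding power_mult by (simp add: power_divide field_simps)
  define c where "c = v ^ k"
  define C where "C = c * c"
  define \<delta> :: real where "\<delta> = (7/4) * 7 ^ (2 * k)"
  have \<delta>: "0 < \<delta>" by (simp add: \<delta>_def)
  have C: "C = v ^ (2 * k)" by (simp add: C_def c_def power_add[symmetric] mult_2)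
  have sad: "self_adjoint d" using sa by (simp add: d_def self_adjoint_intros)
  then have sau: "self_adjoint u" by (simp add: u_def self_adjoint_intros)
  then have sav: "self_adjoint v"
    unfolding v_def by (rule positive_element_self_adjoint[OF positive_element_square])
  \<comment> \<open>Since \<open>d * d \<le> 1\<close>, this gives \<open>v - 7 \<le> 4 * d - 2\<close>, and the spectral value \<open>1\<close> of \<open>d\<close>
    corresponds to the value \<open>9 > 7\<close> of \<open>v\<close>.\<close>
  have v: "v = 4 *\<^sub>R 1 + 4 *\<^sub>R d + d * d"
    by (simp add: v_def u_def algebra_simps) (simp flip: scaleR_add_left)
  have "invertible_element u"
    using invertible_element_scaleR_one_diff[of "- d" 2] d by (simp add: u_def d_def[symmetric])
  then have inv_c: "invertible_element c"
    unfolding c_def v_def by (intro invertible_element_power invertible_element_mult)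
  have sac: "self_adjoint c" using sav by (simp add: c_def self_adjoint_power)
  have conj: "positive_element (c * x * c)" if "positive_element x" for x
    using that sac inv_c by (rule positive_element_conjugate)
  have bound: "positive_element (r *\<^sub>R C - c * x * c)" if "self_adjoint x" "norm x \<le> r" for x r
    using conj[OF positive_element_scaleR_one_diff[OF that]] by (simp add: C_def algebra_simps)

  have "positive_element (1 *\<^sub>R 1 - d * d)"
    using d positive_element_square[OF sad] norm_self_adjoint_square[OF sad]
    by (intro positive_element_scaleR_one_diff positive_element_self_adjoint) (simp_all add: d_def)
  from conj[OF this] have p1: "positive_element (c * (1 - d * d) * c)" by simp
  have p2: "positive_element ((v - 7 *\<^sub>R 1) * C + 7 ^ Suc (2 * k) *\<^sub>R 1)"
    using positive_element_power_diff[OF sau, of 7 "2 * k"] by (simp only: C v_def)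
  \<comment> \<open>The terms in \<open>d * d\<close> cancel, leaving c (4 d - 2) c; division by 4
    turns the error 7^(2k+1) into \<delta>.\<close>
  have "positive_element ((1/4) *\<^sub>R
      (c * (1 - d * d) * c + ((v - 7 *\<^sub>R 1) * C + 7 ^ Suc (2 * k) *\<^sub>R 1)))"
    by (rule positive_element_scaleR[OF positive_element_add[OF p1 p2]]) simp
  also have "(1/4) *\<^sub>R (c * (1 - d * d) * c + ((v - 7 *\<^sub>R 1) * C + 7 ^ Suc (2 * k) *\<^sub>R 1))
    = c * d * c - (1/2) *\<^sub>R C + \<delta> *\<^sub>R 1"
  proof -
    have "(v - 7 *\<^sub>R 1) * c = c * (v - 7 *\<^sub>R 1)"
      by (simp add: c_def left_diff_distrib right_diff_distrib power_commutes)
    then have "(v - 7 *\<^sub>R 1) * C = c * (v - 7 *\<^sub>R 1) * c"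
      by (simp only: C_def mult.assoc[symmetric])
    moreover have "c * (1 - d * d) * c + c * (v - 7 *\<^sub>R 1) * c = c * ((1 - d * d) + (v - 7 *\<^sub>R 1)) * c"
      by (simp only: distrib_left distrib_right)
    moreover have "(1 - d * d) + (v - 7 *\<^sub>R 1) = 4 *\<^sub>R d - 2 *\<^sub>R 1"
    proof -
      have "7 *\<^sub>R (1::'a) = 1 + 2 *\<^sub>R 1 + 4 *\<^sub>R 1"
        using scaleR_add_left[of 1 2 "1::'a"] scaleR_add_left[of 3 4 "1::'a"] by simp
      then show ?thesis by (simp only: v) simp
    qed
    moreover have "c * (4 *\<^sub>R d - 2 *\<^sub>R 1) * c = 4 *\<^sub>R (c * d * c) - 2 *\<^sub>R C"
      by (simp add: C_def left_diff_distrib right_diff_distrib)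
    ultimately have "c * (1 - d * d) * c + ((v - 7 *\<^sub>R 1) * C + 7 ^ Suc (2 * k) *\<^sub>R 1)
      = 4 *\<^sub>R (c * d * c) - 2 *\<^sub>R C + 7 ^ Suc (2 * k) *\<^sub>R 1"
      by (simp only: add.assoc[symmetric])
    then show ?thesis
      by (simp only: scaleR_add_right scaleR_diff_right scaleR_scaleR \<delta>_def) simp
  qed
  finally have key: "positive_element (c * d * c - (1/2) *\<^sub>R C + \<delta> *\<^sub>R 1)" .

  have cdc: "c * d * c = c * a * c - c * b * c" by (simp add: d_def algebra_simps)
  have sas: "self_adjoint (c * a * c)" "self_adjoint (c * b * c)"
    using sa sac by (simp_all add: self_adjoint_conjugate)
  \<comment> \<open>The extra \<delta> supplies the strict inequality that
    \<open>equal_spectrum_upper_bound\<close> requires.\<close>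
  have Ha: "positive_element ((2 * \<beta> * \<delta> + \<delta>) *\<^sub>R 1 - c * a * c)"
  proof (rule equal_spectrum_upper_bound[where B = "c * b * c" and C = C and \<beta> = \<beta> and \<delta> = \<delta>])
    show "positive_element (c * a * c - c * b * c - (1/2) *\<^sub>R C + \<delta> *\<^sub>R 1)"
      using key by (simp only: cdc)
    show "positive_element (\<beta> *\<^sub>R C - c * b * c)" by (rule bound) (simp_all add: sa \<beta>_def)
  qed (use \<alpha>\<beta> \<delta> sas H[OF sac inv_c] in simp_all)
  \<comment> \<open>The pair (-b, -a) has the same difference \<open>d\<close>, so
    \<open>key\<close> applies again.\<close>
  have Hb: "positive_element ((2 * \<alpha> * \<delta> + \<delta>) *\<^sub>R 1 - (- (c * b * c)))"
  proof (rule equal_spectrum_upper_bound[where B = "- (c * a * c)" and C = C and \<beta> = \<alpha> and \<delta> = \<delta>])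
    show "positive_element (- (c * b * c) - - (c * a * c) - (1/2) *\<^sub>R C + \<delta> *\<^sub>R 1)"
      using key by (simp add: cdc)
    show "positive_element (\<alpha> *\<^sub>R C - - (c * a * c))"
      using bound[of "- a" \<alpha>] sa by (simp add: \<alpha>_def self_adjoint_minus)
    have flip: "invertible_element (s *\<^sub>R 1 - - x) \<longleftrightarrow> invertible_element ((- s) *\<^sub>R 1 - x)" for s and x :: 'a
      using invertible_element_scaleR_iff[of "-1" "s *\<^sub>R 1 - - x"] by simp
    show "invertible_element (s *\<^sub>R 1 - - (c * b * c)) \<longleftrightarrow> invertible_element (s *\<^sub>R 1 - - (c * a * c))" for s
      unfolding flip by (rule H[OF sac inv_c, symmetric])
  qed (use \<alpha>\<beta> \<delta> sas in \<open>simp_all add: self_adjoint_minus\<close>)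
  have "positive_element (2 *\<^sub>R (((2 * \<beta> * \<delta> + \<delta>) *\<^sub>R 1 - c * a * c)
      + ((2 * \<alpha> * \<delta> + \<delta>) *\<^sub>R 1 - - (c * b * c)) + (c * d * c - (1/2) *\<^sub>R C + \<delta> *\<^sub>R 1)))"
    by (intro positive_element_scaleR positive_element_add Ha Hb key) simp
  also have "2 *\<^sub>R (((2 * \<beta> * \<delta> + \<delta>) *\<^sub>R 1 - c * a * c)
      + ((2 * \<alpha> * \<delta> + \<delta>) *\<^sub>R 1 - - (c * b * c)) + (c * d * c - (1/2) *\<^sub>R C + \<delta> *\<^sub>R 1))
    = (2 * ((2 * \<beta> * \<delta> + \<delta>) + (2 * \<alpha> * \<delta> + \<delta>) + \<delta>)) *\<^sub>R 1 - C"
  proof -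
    have comb: "X *\<^sub>R 1 - p + (Y *\<^sub>R 1 - - q) + (p - q - r + Z *\<^sub>R 1) = (X + Y + Z) *\<^sub>R 1 - r"
      for X Y Z and p q r :: 'a
      by (simp add: algebra_simps)
    show ?thesis
      unfolding cdc comb by (simp add: scaleR_diff_right)
  qed
  also have "2 * ((2 * \<beta> * \<delta> + \<delta>) + (2 * \<alpha> * \<delta> + \<delta>) + \<delta>) = L * 7 ^ (2 * k)"
    by (simp add: L_def \<delta>_def algebra_simps)
  \<comment> \<open>A strictly positive scalar plus a positive element.\<close>
  finally have "invertible_element ((9 ^ (2 * k) - L * 7 ^ (2 * k)) *\<^sub>R 1
      + ((L * 7 ^ (2 * k)) *\<^sub>R 1 - C))"
    using k by (simp add: positive_element_iff)
  then have "invertible_element (9 ^ (2 * k) *\<^sub>R 1 - v ^ (2 * k))"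
    by (simp add: C scaleR_diff_left)
  then have "invertible_element (9 *\<^sub>R 1 - v)"
    by (rule invertible_element_diff_if_power_diff)
  moreover have "9 *\<^sub>R 1 - v = (1 - d) * (5 *\<^sub>R 1 + d)"
    using scaleR_add_left[of 1 4 d] scaleR_add_left[of 4 5 "1::'a"] by (simp add: v algebra_simps)
  moreover have "(1 - d) * (5 *\<^sub>R 1 + d) = (5 *\<^sub>R 1 + d) * (1 - d)"
    by (simp add: algebra_simps)
  ultimately show ?thesis unfolding d_def[symmetric] by (metis invertible_element_factor)
qed

theorem lemma6:
  fixes a b :: "'a::unital_cstar_algebra"
  assumes "self_adjoint a" and "self_adjoint b"
    and "\<And>y::'a. positive_element y \<Longrightarrow> invertible_element y \<Longrightarrow> spectrum (a * y) = spectrum (b * y)"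
  shows "a = b"
proof (rule ccontr)
  assume "a \<noteq> b"
  then have n: "0 < norm (a - b)" by simp
  have H: "invertible_element (s *\<^sub>R 1 - c * a * c) \<longleftrightarrow> invertible_element (s *\<^sub>R 1 - c * b * c)"
    if c: "self_adjoint c" "invertible_element c" for c and s :: real
  proof -
    obtain e where e: "c * e = 1" "e * c = 1" using c(2) by (auto simp: invertible_element_def)
    have inv_e: "invertible_element e" using e by (auto intro: invertible_elementI)
    \<comment> \<open>Conjugating by \<open>e\<close> on the left and \<open>c\<close> on the right
      moves both factors \<open>c\<close> to one side, giving the admissible y = c^2.\<close>
    have conj: "invertible_element (s *\<^sub>R 1 - c * x * c) \<longleftrightarrow> of_real s \<notin> spectrum (x * (c * c))" for x
    proof -
      have "e * (s *\<^sub>R 1 - c * x * c) * c = s *\<^sub>R (e * c) - (e * c) * x * (c * c)"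
        by (simp add: algebra_simps)
      then have "e * (s *\<^sub>R 1 - c * x * c) * c = s *\<^sub>R 1 - x * (c * c)" by (simp add: e)
      then show ?thesis
        using invertible_element_conjugate_iff[OF inv_e c(2), of "s *\<^sub>R 1 - c * x * c"]
        by (simp add: spectrum_def scaleR_scaleC)
    qed
    show ?thesis
      unfolding conj
      using assms(3)[OF positive_element_square[OF c(1)] invertible_element_mult[OF c(2) c(2)]]
      by simp
  qed
  \<comment> \<open>Both signs of r are covered; \<open>H\<close> survives the scaling because s
    ranges over all reals.\<close>
  have inv: "invertible_element (1 - r *\<^sub>R (a - b))" if r: "\<bar>r\<bar> = 1 / norm (a - b)" for r
  proof -
    have r0: "r \<noteq> 0" using r n by auto
    have scale: "s *\<^sub>R 1 - c * (r *\<^sub>R x) * c = r *\<^sub>R ((s / r) *\<^sub>R 1 - c * x * c)" for s c and x :: 'a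
      using r0 by (simp add: scaleR_diff_right)
    have "invertible_element (1 - (r *\<^sub>R a - r *\<^sub>R b))"
    proof (rule invertible_element_one_minus_difference)
      show "norm (r *\<^sub>R a - r *\<^sub>R b) = 1"
        unfolding scaleR_diff_right[symmetric] norm_scaleR r using n by simp
      fix c :: 'a and s :: real assume "self_adjoint c" "invertible_element c"
      then show "invertible_element (s *\<^sub>R 1 - c * (r *\<^sub>R a) * c) \<longleftrightarrow>
          invertible_element (s *\<^sub>R 1 - c * (r *\<^sub>R b) * c)"
        unfolding scale invertible_element_scaleR_iff[OF r0] by (rule H)
    qed (use assms in \<open>simp_all add: self_adjoint_scaleR\<close>)
    then show ?thesis by (simp only: scaleR_diff_right)
  qed
  define y where "y = (1 / norm (a - b)) *\<^sub>R (a - b)"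
  have "self_adjoint y" "norm y = 1"
    using assms n by (simp_all add: y_def self_adjoint_intros)
  moreover have "invertible_element (1 - y)" "invertible_element (1 + y)"
    using inv[of "1 / norm (a - b)"] inv[of "- (1 / norm (a - b))"] by (simp_all add: y_def)
  ultimately show False using self_adjoint_norm_one_not_invertible by blast
qed

end
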